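(* Let $L:\mathbb{R}^d\to\mathbb{R}$ be three-times differentiable, let $\eta>0$, and let $\{w(t)\}_{t\ge 0}$ follow the gradient descent central flow (projection formulation), i.e. for almost all $t$, $\frac{dw}{dt}=\mathrm{proj}_{T_{\mathbb{S}_\eta}(w)}[-\eta\nabla L(w)]$. Then for almost all $t$, $$\frac{dL(w(t))}{dt}\le 0 .$$
   Context: $H(w)=\nabla^2 L(w)$ is the Hessian and $S(w)=\lambda_{\max}(H(w))$ its largest eigenvalue (the sharpness). The stable set is $\mathbb{S}_\eta=\{w\in\mathbb{R}^d: S(w)\le 2/\eta\}$. The critical subspace is $\mathcal{U}(w)=\ker[H(w)-\tfrac{2}{\eta}I]$. $\nabla H(w)[z]$ is the symmetric matrix with entries $\sum_p \frac{\partial H_{ij}(w)}{\partial w_p}z_p$ (directional derivative of the Hessian in direction $z$). For a symmetric matrix $A$ and a subspace $\mathcal{U}$, $A\preceq_{\mathcal{U}}0$ means $u^\top A u\le 0$ for all $u\in\mathcal{U}$. For $w\in\mathbb{S}_\eta$, the tangent cone is $T_{\mathbb{S}_\eta}(w)=\{z\in\mathbb{R}^d:\nabla H(w)[z]\preceq_{\mathcal{U}(w)}0\}$, and $\mathrm{proj}_M(v)=\arg\min_{z\in M}\|v-z\|_2^2$ denotes Euclidean projection. A trajectory $w(t)\in\mathbb{S}_\eta$, $t\ge0$, follows the gradient descent central flow if, in the Carathéodory sense (so $w$ is absolutely continuous on compact intervals), for almost all $t$ one has $\frac{dw}{dt}=\mathrm{proj}_{T_{\mathbb{S}_\eta}(w)}[-\eta\nabla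 L(w)]$. *)

theory Defs
  imports "HOL-Analysis.Analysis"
begin

definition partial_deriv :: "'n::finite \<Rightarrow> (real^'n \<Rightarrow> real) \<Rightarrow> real^'n \<Rightarrow> real" where
  "partial_deriv i f w = deriv (\<lambda>s. f (w + s *\<^sub>R axis i 1)) 0"

definition grad :: "(real^'n \<Rightarrow> real) \<Rightarrow> real^'n \<Rightarrow> real^'n" where
  "grad L w = (\<chi> i. partial_deriv i L w)"

definition hess :: "(real^'n \<Rightarrow> real) \<Rightarrow> real^'n \<Rightarrow> real^'n^'n" where
  "hess L w = (\<chi> i j. partial_deriv j (\<lambda>v. partial_deriv i L v) w)"

definition hess_deriv :: "(real^'n \<Rightarrow> real) \<Rightarrow> real^'n \<Rightarrow> real^'n \<Rightarrow> real^'n^'n" where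
  "hess_deriv L w z = (\<chi> i j. \<Sum>p\<in>UNIV. partial_deriv p (\<lambda>v. hess L v $ i $ j) w * z $ p)"

(* Differentiability is total (Frechet). The gradient and the Hessian are the coordinate
   forms of the first and second derivative maps, so this says that L, DL and D(DL) are
   differentiable everywhere; no continuity of the third derivative is required. *)
definition thrice_differentiable :: "(real^'n \<Rightarrow> real) \<Rightarrow> bool" where
  "thrice_differentiable L \<longleftrightarrow>
     (\<forall>w. L differentiable (at w)) \<and>
     (\<forall>w. grad L differentiable (at w)) \<and>
     (\<forall>w. hess L differentiable (at w))"

definition eigenvalues :: "real^'n^'n \<Rightarrow> real set" where
  "eigenvalues A = {l. \<exists>v. v \<noteq> 0 \<and> A *v v = l *\<^sub>R v}"

(* Intended for symmetric A, whose set of real eigenvalues is finite and nonempty.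
   The Hessian of a thrice differentiable function is symmetric. *)
definition lambda_max :: "real^'n^'n \<Rightarrow> real" where
  "lambda_max A = Max (eigenvalues A)"

definition sharpness :: "(real^'n \<Rightarrow> real) \<Rightarrow> real^'n \<Rightarrow> real" where
  "sharpness L w = lambda_max (hess L w)"

definition stable_set :: "(real^'n \<Rightarrow> real) \<Rightarrow> real \<Rightarrow> (real^'n) set" where
  "stable_set L \<eta> = {w. sharpness L w \<le> 2 / \<eta>}"

definition critical_subspace :: "(real^'n \<Rightarrow> real) \<Rightarrow> real \<Rightarrow> real^'n \<Rightarrow> (real^'n) set" where
  "critical_subspace L \<eta> w = {u. (hess L w - (2 / \<eta>) *\<^sub>R mat 1) *v u = 0}"

definition nonpos_on :: "(real^'n) set \<Rightarrow> real^'n^'n \<Rightarrow> bool" where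
  "nonpos_on U A \<longleftrightarrow> (\<forall>u\<in>U. u \<bullet> (A *v u) \<le> 0)"

definition stable_tangent_cone ::
    "(real^'n \<Rightarrow> real) \<Rightarrow> real \<Rightarrow> real^'n \<Rightarrow> (real^'n) set" where
  "stable_tangent_cone L \<eta> w = {z. nonpos_on (critical_subspace L \<eta> w) (hess_deriv L w z)}"

definition eucl_proj :: "(real^'n) set \<Rightarrow> real^'n \<Rightarrow> real^'n" where
  "eucl_proj M v = arg_min_on (\<lambda>z. (norm (v - z))\<^sup>2) M"

definition abs_continuous_on_Icc :: "real \<Rightarrow> real \<Rightarrow> (real \<Rightarrow> real^'n) \<Rightarrow> bool" where
  "abs_continuous_on_Icc a b f \<longleftrightarrow>
     (\<forall>\<epsilon>>0. \<exists>\<delta>>0. \<forall>(n::nat) p q.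
        (\<forall>i<n. a \<le> p i \<and> p i \<le> q i \<and> q i \<le> b) \<and>
        (\<forall>i<n. \<forall>j<n. i \<noteq> j \<longrightarrow> {p i<..<q i} \<inter> {p j<..<q j} = {}) \<and>
        (\<Sum>i<n. q i - p i) < \<delta>
        \<longrightarrow> (\<Sum>i<n. norm (f (q i) - f (p i))) < \<epsilon>)"

(* A trajectory is a function on all reals of which only the values at t >= 0 matter:
   derivatives are taken within [0, \<infinity>), which is two-sided except at t = 0. *)
definition central_flow :: "(real^'n \<Rightarrow> real) \<Rightarrow> real \<Rightarrow> (real \<Rightarrow> real^'n) \<Rightarrow> bool" where
  "central_flow L \<eta> w \<longleftrightarrow>
     (\<forall>t\<ge>0. w t \<in> stable_set L \<eta>) \<and>
     (\<forall>a b. 0 \<le> a \<and> a \<le> b \<longrightarrow> abs_continuous_on_Icc a b w) \<and>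
     (AE t in lebesgue_on {0..}.
        (w has_vector_derivative
           eucl_proj (stable_tangent_cone L \<eta> (w t)) (- (\<eta> *\<^sub>R grad L (w t))))
        (at t within {0..}))"

end

(* Let p be the projection of v = -eta * grad L onto the closed cone T. Since 0 lies in T, the
   minimality of p gives |v - p|^2 <= |v|^2, hence 2 (v . p) >= |p|^2 >= 0. By the chain rule
   the derivative of L along the flow is grad L . p = -(v . p) / eta <= 0. *)
theory Submission
  imports Defs
begin

text \<open>A linear map is determined by its values on the standard basis, and on
  \<open>axis i 1\<close> the Frechet derivative gives the \<open>i\<close>-th partial derivative.
  Differentiability also guarantees that the \<open>deriv\<close> inside
  \<open>partial_deriv\<close> is a genuine derivative.\<close>

lemma has_derivative_grad:
  fixes L :: "real^'n \<Rightarrow> real"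
  assumes "L differentiable (at w)"
  shows "(L has_derivative (\<lambda>z. grad L w \<bullet> z)) (at w)"
proof -
  obtain L' where L': "(L has_derivative L') (at w)"
    using assms by (auto simp: differentiable_def)
  interpret bounded_linear L'
    using L' by (rule has_derivative_bounded_linear)
  have partial: "partial_deriv i L w = L' (axis i 1)" for i
  proof -
    have "((\<lambda>s::real. w + s *\<^sub>R axis i 1) has_vector_derivative axis i 1) (at 0)"
      by (auto intro!: derivative_eq_intros)
    \<comment> \<open>The chain rule wants the outer derivative at the value of the line at
      parameter 0, within the image of the line.\<close>
    moreover have "(L has_derivative L') (at (w + 0 *\<^sub>R axis i 1) within range (\<lambda>s. w + s *\<^sub>R axis i 1))"
      using L' by (simp add: has_derivative_at_withinI)
    ultimately have "((L \<circ> (\<lambda>s. w + s *\<^sub>R axis i 1)) has_vector_derivative L' (axis i 1)) (at 0)"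
      by (rule vector_derivative_diff_chain_within)
    then show ?thesis
      by (simp add: partial_deriv_def o_def has_real_derivative_iff_has_vector_derivative DERIV_imp_deriv)
  qed
  have "L' z = grad L w \<bullet> z" for z
  proof -
    have "L' z = L' (\<Sum>i\<in>UNIV. z $ i *\<^sub>R axis i 1)"
      using basis_expansion[of z] by (simp add: scalar_mult_eq_scaleR)
    also have "\<dots> = grad L w \<bullet> z"
      by (simp add: sum scaleR partial grad_def inner_vec_def mult.commute)
    finally show ?thesis .
  qed
  then have "L' = (\<lambda>z. grad L w \<bullet> z)"
    by blast
  with L' show ?thesis
    by simp
qed

text \<open>For fixed \<open>u\<close> the form is a finite sum linear in \<open>z\<close>, so each
  \<open>u\<close> contributes one closed condition. Closedness is what makes a nearest point
  exist.\<close>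

lemma closed_stable_tangent_cone: "closed (stable_tangent_cone L \<eta> w)"
proof -
  have "stable_tangent_cone L \<eta> w =
      (\<Inter>u\<in>critical_subspace L \<eta> w. {z. u \<bullet> (hess_deriv L w z *v u) \<le> 0})"
    by (auto simp: stable_tangent_cone_def nonpos_on_def)
  moreover have "closed {z. u \<bullet> (hess_deriv L w z *v u) \<le> 0}" for u
    unfolding hess_deriv_def matrix_vector_mult_def inner_vec_def
    by (intro closed_Collect_le) (simp_all, intro continuous_intros)
  ultimately show ?thesis
    by auto
qed

lemma zero_in_stable_tangent_cone: "0 \<in> stable_tangent_cone L \<eta> w"
  by (simp add: stable_tangent_cone_def nonpos_on_def hess_deriv_def
      matrix_vector_mult_def inner_vec_def)

text \<open>\<open>eucl_proj\<close> is a choice, which is meaningful once some minimiser exists. A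
  nonempty closed set in finite dimension has one.\<close>

lemma norm_diff_eucl_proj_le:
  assumes "closed M" and "z \<in> M"
  shows "norm (v - eucl_proj M v) \<le> norm (v - z)"
proof -
  obtain x where "x \<in> M" and "\<And>y. y \<in> M \<Longrightarrow> dist v x \<le> dist v y"
    using distance_attains_inf[of M v] assms by blast
  \<comment> \<open>Squaring is monotone on nonnegative reals, so a nearest point also minimises the
    squared distance.\<close>
  then have "is_arg_min (\<lambda>z. (norm (v - z))\<^sup>2) (\<lambda>z. z \<in> M) x"
    by (auto simp: is_arg_min_linorder dist_norm intro: power_mono)
  \<comment> \<open>One witness suffices: \<open>someI\<close> passes the minimising property to the
    chosen point.\<close>
  then have "is_arg_min (\<lambda>z. (norm (v - z))\<^sup>2) (\<lambda>z. z \<in> M) (eucl_proj M v)"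
    unfolding eucl_proj_def arg_min_on_def arg_min_def by (rule someI)
  then show ?thesis
    using assms(2) by (auto simp: is_arg_min_linorder intro: power2_le_imp_le)
qed

lemma inner_eucl_proj_nonneg:
  assumes "closed M" and "0 \<in> M"
  shows "0 \<le> v \<bullet> eucl_proj M v"
proof -
  let ?p = "eucl_proj M v"
  have "(norm (v - ?p))\<^sup>2 \<le> (norm v)\<^sup>2"
    using norm_diff_eucl_proj_le[OF assms, of v] by (simp add: power_mono)
  \<comment> \<open>Expand the left square and cancel the square of \<open>norm v\<close>.\<close>
  then have "?p \<bullet> ?p \<le> 2 * (v \<bullet> ?p)"
    by (simp add: power2_norm_eq_inner inner_diff_left inner_diff_right inner_commute)
  then show ?thesis
    using inner_ge_zero[of ?p] by linarith
qed

theorem proposition1: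
  fixes L :: "real^'n \<Rightarrow> real" and \<eta> :: real and w :: "real \<Rightarrow> real^'n"
  assumes "thrice_differentiable L"
    and "\<eta> > 0"
    and "central_flow L \<eta> w"
  shows "AE t in lebesgue_on {0..}.
           \<exists>D. ((\<lambda>s. L (w s)) has_real_derivative D) (at t within {0..}) \<and> D \<le> 0"
proof -
  let ?p = "\<lambda>t. eucl_proj (stable_tangent_cone L \<eta> (w t)) (- (\<eta> *\<^sub>R grad L (w t)))"
  have "AE t in lebesgue_on {0..}. (w has_vector_derivative ?p t) (at t within {0..})"
    using assms(3) by (simp add: central_flow_def)
  then show ?thesis
  proof eventually_elim
    case (elim t)
    \<comment> \<open>Restricting to the image of the trajectory matches the one-sided derivative of
      \<open>w\<close> at time 0.\<close>
    have "(L has_derivative (\<lambda>z. grad L (w t) \<bullet> z)) (at (w t) within w ` {0..})"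
      using assms(1) by (simp add: thrice_differentiable_def has_derivative_grad has_derivative_at_withinI)
    with elim have "((L \<circ> w) has_vector_derivative grad L (w t) \<bullet> ?p t) (at t within {0..})"
      by (rule vector_derivative_diff_chain_within)
    \<comment> \<open>The projected vector carries the factor -\<eta>, which reverses the sign of
      the inner product; \<eta> > 0 is then divided out.\<close>
    moreover have "\<eta> * (grad L (w t) \<bullet> ?p t) \<le> 0"
      using inner_eucl_proj_nonneg[OF closed_stable_tangent_cone zero_in_stable_tangent_cone,
          of "- (\<eta> *\<^sub>R grad L (w t))" L \<eta> "w t"] by simp
    then have "grad L (w t) \<bullet> ?p t \<le> 0"
      using assms(2) by (simp add: mult_le_0_iff)
    ultimately show ?case
      by (auto simp: o_def has_real_derivative_iff_has_vector_derivative)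
  qed
qed

end
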